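(* Let $\mathcal{B}=(\beta,\dots,\beta)$, $0<\beta\le1$, and $\mathcal{V}=(\nu,\dots,\nu)$, $\nu>0$, be vectors of length $m$, and let $Z$ be an $m\times m$ complex matrix with Jordan decomposition $Z=M(\Lambda+N)M^{-1}$. Then 1. for the matrix-valued Mittag-Leffler function $E_{\mathcal{B},\mathcal{V}}(Z)$ the following representation is valid: $$E_{\mathcal{B},\mathcal{V}}(Z)=M\,E_{\mathcal{B},\mathcal{V}}(\Lambda+N)\,M^{-1};$$ 2. the following Laplace transform formula holds: $$\mathcal{L}\big[It^{\mathcal{V}-\mathbf{1}}E_{\mathcal{B},\mathcal{V}}(It^{\mathcal{B}}Z)\big](s)=Is^{\mathcal{B}-\mathcal{V}}(Is^{\mathcal{B}}-Z)^{-1},$$ where $\mathcal{V}-\mathbf{1}=(\nu-1,\dots,\nu-1)$ and $It^{\mathcal{B}}=\mathrm{diag}(t^\beta,\dots,t^\beta)$.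
   Context: For vectors $\mathcal{B}=(\beta_1,\dots,\beta_m)$, $\mathcal{V}=(\nu_1,\dots,\nu_m)$ with positive components and an $m\times m$ complex matrix $Z$, the vector-indiced matrix-valued Mittag-Leffler function is $$E_{\mathcal{B},\mathcal{V}}(Z)=\sum_{n=0}^\infty\big(I\Gamma(n\mathcal{B}+\mathcal{V})\big)^{-1}Z^n,\qquad I\Gamma(n\mathcal{B}+\mathcal{V})=\mathrm{diag}\big(\Gamma(n\beta_1+\nu_1),\dots,\Gamma(n\beta_m+\nu_m)\big).$$ For a vector exponent $\mathcal{W}=(w_1,\dots,w_m)$, $It^{\mathcal{W}}=\mathrm{diag}(t^{w_1},\dots,t^{w_m})$, and similarly $Is^{\mathcal{W}}$. In the Jordan decomposition $M$ is invertible, $\Lambda$ is diagonal with the eigenvalues of $Z$ on the diagonal, and $N$ is nilpotent. $\mathcal{L}[f](s)=\int_0^\infty e^{-st}f(t)\,dt$ is the Laplace transform, applied entrywise, for sufficiently large $s>0$. *)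

theory Defs
  imports "HOL-Analysis.Analysis"
begin

definition diagm :: "complex ^ 'n \<Rightarrow> complex ^ 'n ^ 'n" where
  "diagm d = (\<chi> i j. if i = j then d $ i else 0)"

definition diagonal :: "complex ^ 'n ^ 'n \<Rightarrow> bool" where
  "diagonal A \<longleftrightarrow> (\<forall>i j. i \<noteq> j \<longrightarrow> A $ i $ j = 0)"

text \<open>The class operation \<open>*\<close> on \<^typ>\<open>'a ^ 'n ^ 'n\<close>, and hence \<open>^\<close>, is componentwise.
  The following is the power with respect to the matrix product \<open>**\<close>.\<close>

primrec matpow :: "complex ^ 'n ^ 'n \<Rightarrow> nat \<Rightarrow> complex ^ 'n ^ 'n" where
  "matpow A 0 = mat 1"
| "matpow A (Suc n) = A ** matpow A n"

definition nilpotent :: "complex ^ 'n ^ 'n \<Rightarrow> bool" where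
  "nilpotent A \<longleftrightarrow> (\<exists>k. matpow A k = 0)"

definition eigenvalue :: "complex ^ 'n ^ 'n \<Rightarrow> complex \<Rightarrow> bool" where
  "eigenvalue A c \<longleftrightarrow> (\<exists>v. v \<noteq> 0 \<and> A *v v = c *s v)"

definition IGamma :: "real ^ 'n \<Rightarrow> complex ^ 'n ^ 'n" where
  "IGamma W = diagm (\<chi> i. complex_of_real (Gamma (W $ i)))"

definition Ipow :: "real \<Rightarrow> real ^ 'n \<Rightarrow> complex ^ 'n ^ 'n" where
  "Ipow t W = diagm (\<chi> i. complex_of_real (t powr (W $ i)))"

definition mittag_leffler_term ::
    "real ^ 'n \<Rightarrow> real ^ 'n \<Rightarrow> complex ^ 'n ^ 'n \<Rightarrow> nat \<Rightarrow> complex ^ 'n ^ 'n" where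
  "mittag_leffler_term B V Z n = matrix_inv (IGamma (real n *\<^sub>R B + V)) ** matpow Z n"

definition mittag_leffler ::
    "real ^ 'n \<Rightarrow> real ^ 'n \<Rightarrow> complex ^ 'n ^ 'n \<Rightarrow> complex ^ 'n ^ 'n" where
  "mittag_leffler B V Z = (\<Sum>n. mittag_leffler_term B V Z n)"

text \<open>The Laplace integral is taken as an absolutely convergent Lebesgue integral. As
  \<^const>\<open>set_lebesgue_integral\<close> is total, its existence is recorded by a separate predicate.\<close>

definition laplace_integrable :: "(real \<Rightarrow> complex) \<Rightarrow> real \<Rightarrow> bool" where
  "laplace_integrable f s \<longleftrightarrow> set_integrable lborel {0<..} (\<lambda>t. complex_of_real (exp (- (s * t))) * f t)"

definition laplace :: "(real \<Rightarrow> complex) \<Rightarrow> real \<Rightarrow> complex" where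
  "laplace f s = (LINT t:{0<..}|lborel. complex_of_real (exp (- (s * t))) * f t)"

definition laplace_integrable_mat :: "(real \<Rightarrow> complex ^ 'n ^ 'n) \<Rightarrow> real \<Rightarrow> bool" where
  "laplace_integrable_mat F s \<longleftrightarrow> (\<forall>i j. laplace_integrable (\<lambda>t. F t $ i $ j) s)"

definition laplace_mat :: "(real \<Rightarrow> complex ^ 'n ^ 'n) \<Rightarrow> real \<Rightarrow> complex ^ 'n ^ 'n" where
  "laplace_mat F s = (\<chi> i j. laplace (\<lambda>t. F t $ i $ j) s)"

end

theory Submission
  imports Defs "HOL-Real_Asymp.Real_Asymp"
begin

text \<open>
  For constant index vectors the diagonal matrices built from them are scalar multiples of the
  identity, so \<open>mittag_leffler B V Z\<close> is the ordinary power series \<open>\<Sum>n. Z\<^sup>n / \<Gamma>(n\<beta> + \<nu>)\<close> in \<open>Z\<close>.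
  The proof is the classical one for the scalar function, carried out entry by entry.

  Convergence: the entries of \<open>Z\<^sup>n\<close> are at most \<open>R\<^sup>n\<close>, where \<open>R\<close> is the sum of the absolute
  values of the entries of \<open>Z\<close> (\<open>norm_matpow_entry_le\<close>), whereas \<open>\<Gamma>\<close> grows faster than any exponential (\<open>Gamma_ge_exponential\<close>), so the series converges for every matrix.
  A convergent power series commutes with conjugation because conjugation is linear and continuous
  and respects powers; that is the first formula.

  Laplace transform: the transform of \<open>t powr (a - 1) / \<Gamma>(a)\<close> is \<open>s powr - a\<close>
  (\<open>has_bochner_integral_laplace_powr\<close>). Once \<open>s powr \<beta> > R\<close>, the transformed series converges
  absolutely, and so dominated convergence allows integration term by term
  (\<open>laplace_powr_series\<close>). The result is \<open>\<Sum>n. s powr - (n\<beta> + \<nu>) \<cdot> Z\<^sup>n\<close>, which is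
  \<open>s powr (\<beta> - \<nu>)\<close> times the Neumann series of the inverse of \<open>(s powr \<beta>) - Z\<close>
  (\<open>neumann_series\<close>).
\<close>

section \<open>Matrix algebra and matrix series\<close>

lemma matrix_inv_eqI:
  fixes A C :: "complex ^ 'n ^ 'n"
  assumes "A ** C = mat 1"
  shows "matrix_inv A = C"
proof -
  have CA: "C ** A = mat 1" using assms matrix_left_right_inverse by blast
  have "\<exists>A'. A ** A' = mat 1 \<and> A' ** A = mat 1" using assms CA by blast
  then have left: "matrix_inv A ** A = mat 1"
    unfolding matrix_inv_def by (rule someI2_ex) simp
  have "matrix_inv A = (matrix_inv A ** A) ** C"
    by (simp add: matrix_mul_assoc[symmetric] assms)
  then show ?thesis by (simp add: left)
qed

lemma matrix_inv_left:
  fixes A :: "complex ^ 'n ^ 'n"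
  assumes "invertible A"
  shows "matrix_inv A ** A = mat 1"
proof -
  obtain C where C: "A ** C = mat 1" "C ** A = mat 1"
    using assms unfolding invertible_def by blast
  then show ?thesis using matrix_inv_eqI[OF C(1)] by simp
qed

lemma diagm_const: "diagm (\<chi> i. complex_of_real c) = c *\<^sub>R mat 1"
  by (simp add: diagm_def vec_eq_iff mat_def of_real_def)

lemma Ipow_const: "Ipow t (\<chi> i. w) = (t powr w) *\<^sub>R mat 1"
  by (simp add: Ipow_def diagm_const)

lemma scaleR_mat_1_mult:
  fixes A :: "complex ^ 'n ^ 'n"
  shows "(c *\<^sub>R mat 1) ** A = c *\<^sub>R A"
  by (simp add: scalar_matrix_assoc[symmetric])

lemma matpow_scaleR: "matpow (c *\<^sub>R A) n = c ^ n *\<^sub>R matpow A n"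
  by (induction n) (simp_all add: scalar_matrix_assoc[symmetric] matrix_scalar_ac mult.commute)

lemma matpow_conjugate:
  fixes M A :: "complex ^ 'n ^ 'n"
  assumes "invertible M"
  shows "matpow (M ** A ** matrix_inv M) n = M ** matpow A n ** matrix_inv M"
proof (induction n)
  case 0
  have "M ** matrix_inv M = mat 1"
    using matrix_inv_left[OF assms] matrix_left_right_inverse by blast
  then show ?case by simp
next
  case (Suc n)
  have "matpow (M ** A ** matrix_inv M) (Suc n)
          = M ** A ** (matrix_inv M ** M) ** matpow A n ** matrix_inv M"
    by (simp add: Suc matrix_mul_assoc)
  then show ?case by (simp add: matrix_inv_left[OF assms] matrix_mul_assoc)
qed

text \<open>By induction, since the sum of the absolute values of all entries dominates every row sum. What
  the convergence arguments use is that the base is the same for all \<open>n\<close>.\<close>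

lemma norm_matpow_entry_le:
  fixes A :: "complex ^ 'n ^ 'n"
  shows "norm (matpow A n $ i $ j) \<le> (\<Sum>k\<in>UNIV. \<Sum>l\<in>UNIV. norm (A $ k $ l)) ^ n"
proof (induction n arbitrary: i j)
  case 0
  then show ?case by (simp add: mat_def)
next
  case (Suc n)
  let ?R = "\<Sum>k\<in>UNIV. \<Sum>l\<in>UNIV. norm (A $ k $ l)"
  have "norm (matpow A (Suc n) $ i $ j) = norm (\<Sum>l\<in>UNIV. A $ i $ l * matpow A n $ l $ j)"
    by (simp add: matrix_matrix_mult_def)
  also have "\<dots> \<le> (\<Sum>l\<in>UNIV. norm (A $ i $ l) * ?R ^ n)"
    by (intro sum_norm_le) (simp add: norm_mult mult_left_mono Suc)
  also have "\<dots> = (\<Sum>l\<in>UNIV. norm (A $ i $ l)) * ?R ^ n"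
    by (simp add: sum_distrib_right)
  also have "\<dots> \<le> ?R * ?R ^ n"
    by (intro mult_right_mono member_le_sum[of i UNIV "\<lambda>k. \<Sum>l\<in>UNIV. norm (A $ k $ l)"])
       (simp_all add: sum_nonneg)
  finally show ?case by simp
qed

lemma sums_matrixI:
  fixes f :: "nat \<Rightarrow> complex ^ 'n ^ 'm"
  assumes "\<And>i j. (\<lambda>n. f n $ i $ j) sums (S $ i $ j)"
  shows "f sums S"
  using assms unfolding sums_def by (intro vec_tendstoI) simp

lemma sums_matrixD:
  fixes f :: "nat \<Rightarrow> complex ^ 'n ^ 'm"
  assumes "f sums S"
  shows "(\<lambda>n. f n $ i $ j) sums (S $ i $ j)"
  using tendsto_vec_nth[OF tendsto_vec_nth[OF assms[unfolded sums_def]], of i j]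
  by (simp add: sums_def)

lemma summable_matrixI:
  fixes f :: "nat \<Rightarrow> complex ^ 'n ^ 'm"
  assumes "\<And>i j. summable (\<lambda>n. f n $ i $ j)"
  shows "summable f"
proof -
  have "f sums (\<chi> i j. \<Sum>n. f n $ i $ j)"
    by (rule sums_matrixI) (simp add: assms summable_sums)
  then show ?thesis by (rule sums_summable)
qed

lemma sums_matrix_mult:
  fixes f :: "nat \<Rightarrow> complex ^ 'n ^ 'n"
  assumes "f sums S"
  shows "(\<lambda>n. A ** f n ** C) sums (A ** S ** C)"
  by (intro sums_matrixI)
     (simp add: matrix_matrix_mult_def, intro sums_sum sums_mult sums_mult2 sums_matrixD assms)

lemma matrix_diff_rdistrib:
  fixes A C D :: "complex ^ 'n ^ 'n"
  shows "(A - C) ** D = A ** D - C ** D"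
  by (simp add: matrix_matrix_mult_def vec_eq_iff left_diff_distrib sum_subtractf)

text \<open>If \<open>S\<close> is the sum of the series, multiplication by \<open>c\<close> and by \<open>Z\<close> produces two series that
  differ by a shift of the index, so \<open>(c - Z) S\<close> is the term at \<open>0\<close>, the identity. The
  hypothesis on \<open>c\<close> makes the series converge, by comparison of \<open>norm_matpow_entry_le\<close> with a
  geometric series.\<close>

lemma neumann_series:
  fixes Z :: "complex ^ 'n ^ 'n"
  assumes c: "c > (\<Sum>k\<in>UNIV. \<Sum>l\<in>UNIV. norm (Z $ k $ l))"
  shows "invertible (c *\<^sub>R mat 1 - Z)"
    and "(\<lambda>n. inverse (c ^ Suc n) *\<^sub>R matpow Z n) sums matrix_inv (c *\<^sub>R mat 1 - Z)"
proof -
  define R where "R = (\<Sum>k\<in>UNIV. \<Sum>l\<in>UNIV. norm (Z $ k $ l))"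
  have R: "0 \<le> R" "R < c" using c unfolding R_def by (simp_all add: sum_nonneg)
  define f where "f = (\<lambda>n. inverse (c ^ Suc n) *\<^sub>R matpow Z n)"
  have "summable (\<lambda>n. f n $ i $ j)" for i j
  proof (rule summable_comparison_test')
    show "summable (\<lambda>n. inverse c * (R / c) ^ n)"
      using R by (intro summable_mult summable_geometric) simp
    show "norm (f n $ i $ j) \<le> inverse c * (R / c) ^ n" for n
      using norm_matpow_entry_le[of Z n i j] R
      by (simp add: f_def R_def[symmetric] field_simps)
  qed
  then have "summable f" by (rule summable_matrixI)
  then obtain S where S: "f sums S" by (auto simp: summable_def)
  have "(\<lambda>n. c *\<^sub>R f n) sums (c *\<^sub>R S)" using S by (rule sums_scaleR_right)
  moreover have "c *\<^sub>R f 0 = mat 1" using R by (simp add: f_def)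
  ultimately have "(\<lambda>n. c *\<^sub>R f (Suc n)) sums (c *\<^sub>R S - mat 1)"
    using sums_Suc_iff[of "\<lambda>n. c *\<^sub>R f n" "c *\<^sub>R S - mat 1"] by (metis diff_add_cancel)
  \<comment> \<open>The factor \<open>mat 1\<close> brings the term into the two-sided form of \<open>sums_matrix_mult\<close>.\<close>
  moreover have "c *\<^sub>R f (Suc n) = Z ** f n ** mat 1" for n
    using R by (simp add: f_def matrix_scalar_ac scalar_matrix_assoc[symmetric])
  moreover have "(\<lambda>n. Z ** f n ** mat 1) sums (Z ** S ** mat 1)"
    using S by (rule sums_matrix_mult)
  ultimately have "c *\<^sub>R S - mat 1 = Z ** S" using sums_unique2 by simp blast
  then have inv: "(c *\<^sub>R mat 1 - Z) ** S = mat 1"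
    by (simp add: matrix_diff_rdistrib scaleR_mat_1_mult algebra_simps)
  then show "invertible (c *\<^sub>R mat 1 - Z)"
    using matrix_left_right_inverse unfolding invertible_def by blast
  show "(\<lambda>n. inverse (c ^ Suc n) *\<^sub>R matpow Z n) sums matrix_inv (c *\<^sub>R mat 1 - Z)"
    using S matrix_inv_eqI[OF inv] by (simp add: f_def)
qed

section \<open>Growth of the Gamma function\<close>

text \<open>Discard the part of Euler's integral below \<open>T\<close> and use that \<open>t powr (x - 1)\<close> is increasing.
  As \<open>T\<close> is arbitrary, this beats every exponential in \<open>x\<close>.\<close>

lemma Gamma_ge_exponential:
  fixes x T :: real
  assumes "x \<ge> 1" "T > 0"
  shows "T powr (x - 1) * exp (- T) \<le> Gamma x"
proof (rule has_integral_le)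
  show "((\<lambda>t. t powr (x - 1) / exp t) has_integral Gamma x) {0..}"
    using Gamma_integral_real[of x] assms by simp
  have "((\<lambda>t. T powr (x - 1) * exp (- t)) has_integral T powr (x - 1) * exp (- T)) {T..}"
    using has_integral_exp_minus_to_infinity[of 1 T] by (intro has_integral_mult_right) simp
  then show "((\<lambda>t. if t \<in> {T..} then T powr (x - 1) * exp (- t) else 0)
               has_integral T powr (x - 1) * exp (- T)) {0..}"
    using assms by (subst has_integral_restrict) auto
  show "(if t \<in> {T..} then T powr (x - 1) * exp (- t) else 0) \<le> t powr (x - 1) / exp t"
    if "t \<in> {0..}" for t
    using that assms by (auto simp: exp_minus field_simps intro!: powr_mono2)
qed

text \<open>The threshold \<open>T\<close> is chosen with \<open>T powr \<beta> = 2 R\<close>, which makes the terms decay like \<open>2\<^sup>-\<^sup>n\<close>.\<close>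

lemma summable_power_over_Gamma:
  fixes R \<beta> \<nu> :: real
  assumes "0 < \<beta>" "0 < \<nu>" "0 \<le> R"
  shows "summable (\<lambda>n. R ^ n / Gamma (real n * \<beta> + \<nu>))"
proof (cases "R = 0")
  case True
  then show ?thesis
    by (intro summable_finite[of "{0}"]) auto
next
  case False
  with assms have R: "R > 0" by simp
  define T where "T = (2 * R) powr (1 / \<beta>)"
  have T: "T > 0" "T powr \<beta> = 2 * R" using R assms by (simp_all add: T_def powr_powr)
  have ev: "\<forall>\<^sub>F n in sequentially. real n \<ge> 1 / \<beta>"
    by real_asymp
  show ?thesis
  proof (rule summable_comparison_test_ev)
    show "summable (\<lambda>n. exp T * T powr (1 - \<nu>) * (1 / 2) ^ n)"
      by (intro summable_mult summable_geometric) simp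
    show "\<forall>\<^sub>F n in sequentially. norm (R ^ n / Gamma (real n * \<beta> + \<nu>))
            \<le> exp T * T powr (1 - \<nu>) * (1 / 2) ^ n"
      using ev
    proof eventually_elim
      case (elim n)
      have "1 \<le> real n * \<beta>" using elim assms by (simp add: field_simps)
      then have ge: "T powr (real n * \<beta> + \<nu> - 1) * exp (- T) \<le> Gamma (real n * \<beta> + \<nu>)"
        using assms T by (intro Gamma_ge_exponential) auto
      have pow: "T powr (real n * \<beta> + \<nu> - 1) = (2 * R) ^ n * T powr (\<nu> - 1)"
        using T powr_power[of T \<beta> n] by (simp add: powr_add[symmetric] algebra_simps)
      have pos: "0 < (2 * R) ^ n * T powr (\<nu> - 1) * exp (- T)" using R T by simp
      have "norm (R ^ n / Gamma (real n * \<beta> + \<nu>)) = R ^ n / Gamma (real n * \<beta> + \<nu>)"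
        using R assms by (simp add: Gamma_real_pos add_nonneg_pos less_imp_le)
      also have "\<dots> \<le> R ^ n / ((2 * R) ^ n * T powr (\<nu> - 1) * exp (- T))"
        using ge pos R unfolding pow by (intro divide_left_mono) auto
      also have "\<dots> = exp T * T powr (1 - \<nu>) * (1 / 2) ^ n"
        using R T powr_minus[of T "\<nu> - 1"] by (simp add: exp_minus field_simps power_mult_distrib)
      finally show ?case .
    qed
  qed
qed

section \<open>Laplace transforms of power series\<close>

text \<open>Euler's integral for \<open>\<Gamma>(a)\<close> after the substitution \<open>t \<mapsto> s t\<close>.\<close>

lemma has_bochner_integral_laplace_powr:
  fixes a s :: real
  assumes a: "0 < a" and s: "0 < s"
  shows "has_bochner_integral lborel
           (\<lambda>t. indicator {0<..} t * (exp (- (s * t)) * (t powr (a - 1) / Gamma a))) (s powr (- a))"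
proof -
  let ?f = "\<lambda>t::real. indicator {0..} t * t powr (a - 1) / exp t"
  have pos: "Gamma a > 0" using a by (rule Gamma_real_pos)
  have "has_bochner_integral lborel ?f (Gamma a)"
  proof (rule has_bochner_integral_nn_integral)
    show "(\<integral>\<^sup>+t. ennreal (?f t) \<partial>lborel) = ennreal (Gamma a)"
      using Gamma_conv_nn_integral_real[OF a] by simp
  qed (use pos in auto)
  then have "has_bochner_integral lborel (\<lambda>t. ?f (0 + s * t)) (Gamma a /\<^sub>R \<bar>s\<bar>)"
    using s lborel_has_bochner_integral_real_affine_iff[of s ?f "Gamma a" 0] by blast
  then have "has_bochner_integral lborel (\<lambda>t. (s powr (1 - a) / Gamma a) * ?f (0 + s * t))
               ((s powr (1 - a) / Gamma a) * (Gamma a /\<^sub>R \<bar>s\<bar>))"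
    by (intro has_bochner_integral_mult_right) simp
  moreover have "(s powr (1 - a) / Gamma a) * ?f (0 + s * t)
      = indicator {0<..} t * (exp (- (s * t)) * (t powr (a - 1) / Gamma a))" for t
  proof (cases "t > 0")
    case True
    have "s powr (1 - a) * (s * t) powr (a - 1) = t powr (a - 1)"
      using True s by (simp add: powr_mult powr_add[symmetric] mult.assoc[symmetric])
    then show ?thesis using True s pos by (simp add: exp_minus field_simps)
  next
    case False
    \<comment> \<open>At \<open>t = 0\<close> the two indicators differ, but \<open>0 powr x\<close> is \<open>0\<close> by convention.\<close>
    then show ?thesis using s by (cases "t = 0") (auto simp: indicator_def zero_le_mult_iff)
  qed
  moreover have "(s powr (1 - a) / Gamma a) * (Gamma a /\<^sub>R \<bar>s\<bar>) = s powr (- a)"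
    using s pos by (simp add: powr_diff powr_minus field_simps)
  ultimately show ?thesis by simp
qed

text \<open>Term-by-term integration. Summability at \<open>s\<close> says that the integrals of the absolute values of
  the terms have a finite sum, and this supplies the integrable majorant that dominated convergence
  needs.\<close>

lemma laplace_powr_series:
  fixes a :: "nat \<Rightarrow> complex" and p :: "nat \<Rightarrow> real"
  assumes s: "0 < s" and p: "\<And>n. 0 < p n"
    and f: "\<And>t. 0 < t \<Longrightarrow> (\<lambda>n. a n * of_real (t powr (p n - 1) / Gamma (p n))) sums f t"
    and abs_f: "\<And>t. 0 < t \<Longrightarrow> summable (\<lambda>n. norm (a n) * (t powr (p n - 1) / Gamma (p n)))"
    and abs_s: "summable (\<lambda>n. norm (a n) * s powr (- p n))"
  shows "laplace_integrable f s"
    and "(\<lambda>n. a n * of_real (s powr (- p n))) sums laplace f s"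
proof -
  define k where "k = (\<lambda>n t. indicator {0<..} t * (exp (- (s * t)) * (t powr (p n - 1) / Gamma (p n))))"
  define g where "g = (\<lambda>n t. a n * complex_of_real (k n t))"
  have k: "has_bochner_integral lborel (k n) (s powr (- p n))" for n
    unfolding k_def using p s by (rule has_bochner_integral_laplace_powr)
  have k_nonneg: "0 \<le> k n t" for n t
    using Gamma_real_pos[OF p, of n] by (simp add: k_def indicator_def)
  have g: "has_bochner_integral lborel (g n) (a n * of_real (s powr (- p n)))" for n
    unfolding g_def using k by (intro has_bochner_integral_mult_right has_bochner_integral_of_real)
  have norm_g: "norm (g n t) = norm (a n) * k n t" for n t
    using k_nonneg[of n t] by (simp add: g_def norm_mult)
  have int_norm: "(LINT t|lborel. norm (g n t)) = norm (a n) * s powr (- p n)" for n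
    using has_bochner_integral_integral_eq[OF k[of n]] by (simp add: norm_g)
  have F: "(\<lambda>n. g n t) sums (indicator {0<..} t *\<^sub>R (of_real (exp (- (s * t))) * f t))" for t
  proof (cases "t > 0")
    case True
    from sums_mult[OF f[OF this], of "of_real (exp (- (s * t)))"] show ?thesis
      using True by (simp add: g_def k_def mult_ac)
  qed (simp add: g_def k_def)
  have sn: "summable (\<lambda>n. norm (g n t))" for t
  proof (cases "t > 0")
    case True
    from summable_mult[OF abs_f[OF this], of "exp (- (s * t))"] show ?thesis
      using True by (simp add: norm_g k_def mult_ac)
  qed (simp add: norm_g k_def)
  have eq: "(\<lambda>t. indicator {0<..} t *\<^sub>R (of_real (exp (- (s * t))) * f t)) = (\<lambda>t. \<Sum>n. g n t)"
    using F by (auto simp: sums_iff)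
  have int: "integrable lborel (g n)" for n
    using g by (simp add: has_bochner_integral_iff)
  have summ: "summable (\<lambda>n. LINT t|lborel. norm (g n t))"
    unfolding int_norm by (rule abs_s)
  show "laplace_integrable f s"
    unfolding laplace_integrable_def set_integrable_def eq
    using int sn summ by (intro integrable_suminf) auto
  have "(\<lambda>n. integral\<^sup>L lborel (g n)) sums (LINT t|lborel. (\<Sum>n. g n t))"
    using int sn summ by (intro sums_integral) auto
  then show "(\<lambda>n. a n * of_real (s powr (- p n))) sums laplace f s"
    unfolding laplace_def set_lebesgue_integral_def eq
    using has_bochner_integral_integral_eq[OF g] by simp
qed

section \<open>The Mittag-Leffler function with constant indices\<close>

lemma mittag_leffler_term_const:
  fixes A :: "complex ^ 'n ^ 'n"
  assumes "0 < \<beta>" "0 < \<nu>"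
  shows "mittag_leffler_term (\<chi> i. \<beta>) (\<chi> i. \<nu>) A n
           = inverse (Gamma (real n * \<beta> + \<nu>)) *\<^sub>R matpow A n"
proof -
  let ?G = "Gamma (real n * \<beta> + \<nu>)"
  have G: "?G > 0" using assms by (intro Gamma_real_pos add_nonneg_pos) auto
  have "IGamma (real n *\<^sub>R (\<chi> i. \<beta>) + (\<chi> i. \<nu>)) = (?G *\<^sub>R mat 1 :: complex ^ 'n ^ 'n)"
    by (simp add: IGamma_def diagm_const)
  moreover have "matrix_inv (?G *\<^sub>R mat 1) = (inverse ?G *\<^sub>R mat 1 :: complex ^ 'n ^ 'n)"
    using G by (intro matrix_inv_eqI) (simp add: scaleR_mat_1_mult)
  ultimately show ?thesis
    by (simp add: mittag_leffler_term_def scaleR_mat_1_mult)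
qed

lemma summable_norm_mittag_leffler_entry:
  fixes A :: "complex ^ 'n ^ 'n"
  assumes "0 < \<beta>" "0 < \<nu>"
  shows "summable (\<lambda>n. norm (mittag_leffler_term (\<chi> i. \<beta>) (\<chi> i. \<nu>) A n $ i $ j))"
proof (rule summable_comparison_test')
  let ?R = "\<Sum>k\<in>UNIV. \<Sum>l\<in>UNIV. norm (A $ k $ l)"
  show "summable (\<lambda>n. ?R ^ n / Gamma (real n * \<beta> + \<nu>))"
    using assms by (intro summable_power_over_Gamma) (simp_all add: sum_nonneg)
  show "norm (norm (mittag_leffler_term (\<chi> i. \<beta>) (\<chi> i. \<nu>) A n $ i $ j))
          \<le> ?R ^ n / Gamma (real n * \<beta> + \<nu>)" for n
  proof -
    have "Gamma (real n * \<beta> + \<nu>) > 0" using assms by (intro Gamma_real_pos add_nonneg_pos) auto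
    then show ?thesis using norm_matpow_entry_le[of A n i j] assms
      by (simp add: mittag_leffler_term_const field_simps)
  qed
qed

lemma mittag_leffler_sums:
  fixes A :: "complex ^ 'n ^ 'n"
  assumes "0 < \<beta>" "0 < \<nu>"
  shows "mittag_leffler_term (\<chi> i. \<beta>) (\<chi> i. \<nu>) A sums mittag_leffler (\<chi> i. \<beta>) (\<chi> i. \<nu>) A"
  unfolding mittag_leffler_def
  by (intro summable_sums summable_matrixI
        summable_norm_cancel[OF summable_norm_mittag_leffler_entry[OF assms]])

lemma mittag_leffler_conjugate:
  fixes M A :: "complex ^ 'n ^ 'n"
  assumes "0 < \<beta>" "0 < \<nu>" and M: "invertible M"
  shows "mittag_leffler (\<chi> i. \<beta>) (\<chi> i. \<nu>) (M ** A ** matrix_inv M)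
           = M ** mittag_leffler (\<chi> i. \<beta>) (\<chi> i. \<nu>) A ** matrix_inv M"
proof -
  have "(\<lambda>n. M ** mittag_leffler_term (\<chi> i. \<beta>) (\<chi> i. \<nu>) A n ** matrix_inv M)
          = mittag_leffler_term (\<chi> i. \<beta>) (\<chi> i. \<nu>) (M ** A ** matrix_inv M)"
    using assms
    by (auto simp: mittag_leffler_term_const matpow_conjugate matrix_scalar_ac scalar_matrix_assoc)
  then show ?thesis
    using sums_matrix_mult[OF mittag_leffler_sums[OF assms(1,2), of A], of M "matrix_inv M"]
      mittag_leffler_sums[OF assms(1,2)] sums_unique2 by metis
qed

text \<open>Multiplication by \<open>t powr (\<nu> - 1)\<close> turns the terms of the series into multiples of
  \<open>t powr (a - 1) / Gamma a\<close> with \<open>a = n \<beta> + \<nu>\<close>, whose transforms are known. The resolvent is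
  multiplied by \<open>s powr (\<beta> - \<nu>)\<close> because the \<open>n\<close>-th transform is \<open>s powr - (n \<beta> + \<nu>)\<close>
  whereas the Neumann series has \<open>s powr - ((n + 1) \<beta>)\<close>.\<close>

lemma laplace_mittag_leffler:
  fixes Z :: "complex ^ 'n ^ 'n"
  assumes \<beta>: "0 < \<beta>" and \<nu>: "0 < \<nu>" and s: "0 < s"
    and large: "s powr \<beta> > (\<Sum>k\<in>UNIV. \<Sum>l\<in>UNIV. norm (Z $ k $ l))"
  defines "F \<equiv> \<lambda>t. (t powr (\<nu> - 1)) *\<^sub>R mittag_leffler (\<chi> i. \<beta>) (\<chi> i. \<nu>) ((t powr \<beta>) *\<^sub>R Z)"
  shows "laplace_integrable_mat F s"
    and "laplace_mat F s = (s powr (\<beta> - \<nu>)) *\<^sub>R matrix_inv ((s powr \<beta>) *\<^sub>R mat 1 - Z)"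
proof -
  define R where "R = (\<Sum>k\<in>UNIV. \<Sum>l\<in>UNIV. norm (Z $ k $ l))"
  have R: "0 \<le> R" "R < s powr \<beta>" using large unfolding R_def by (simp_all add: sum_nonneg)
  define p where "p = (\<lambda>n. real n * \<beta> + \<nu>)"
  have p: "0 < p n" for n using \<beta> \<nu> by (simp add: p_def add_nonneg_pos)
  have term_eq: "(t powr (\<nu> - 1)) *\<^sub>R mittag_leffler_term (\<chi> i. \<beta>) (\<chi> i. \<nu>) ((t powr \<beta>) *\<^sub>R Z) n
                   = (t powr (p n - 1) / Gamma (p n)) *\<^sub>R matpow Z n" if "0 < t" for t n
    using that \<beta> \<nu>
    by (simp add: mittag_leffler_term_const matpow_scaleR powr_power powr_add[symmetric] p_def
        field_simps)
  have s_pow: "s powr (- p n) = s powr (\<beta> - \<nu>) * inverse ((s powr \<beta>) ^ Suc n)" for n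
  proof -
    have "inverse ((s powr \<beta>) ^ Suc n) = s powr (- (real (Suc n) * \<beta>))"
      using s by (simp only: powr_power[of s \<beta> "Suc n"] powr_minus)
    then show ?thesis using s by (simp add: p_def powr_add[symmetric] algebra_simps)
  qed
  have sums_t: "(\<lambda>n. matpow Z n $ i $ j * of_real (t powr (p n - 1) / Gamma (p n))) sums (F t $ i $ j)"
    if t: "0 < t" for t i j
    using sums_matrixD[OF sums_scaleR_right[OF mittag_leffler_sums[OF \<beta> \<nu>, of "(t powr \<beta>) *\<^sub>R Z"],
          of "t powr (\<nu> - 1)"], of i j]
    unfolding F_def term_eq[OF t] by (simp add: scaleR_conv_of_real[where 'a = complex] mult.commute)
  have abs_t: "summable (\<lambda>n. norm (matpow Z n $ i $ j) * (t powr (p n - 1) / Gamma (p n)))"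
    if t: "0 < t" for t i j
  proof -
    have "norm (matpow Z n $ i $ j) * (t powr (p n - 1) / Gamma (p n))
        = t powr (\<nu> - 1) * norm (mittag_leffler_term (\<chi> i. \<beta>) (\<chi> i. \<nu>) ((t powr \<beta>) *\<^sub>R Z) n $ i $ j)" for n
    proof -
      have "norm (matpow Z n $ i $ j) * (t powr (p n - 1) / Gamma (p n))
        = norm (((t powr (p n - 1) / Gamma (p n)) *\<^sub>R matpow Z n) $ i $ j)"
        using Gamma_real_pos[OF p[of n]] by simp
      then show ?thesis by (simp add: term_eq[OF t, symmetric])
    qed
    then show ?thesis
      by (simp add: summable_mult summable_norm_mittag_leffler_entry[OF \<beta> \<nu>])
  qed
  have abs_s: "summable (\<lambda>n. norm (matpow Z n $ i $ j) * s powr (- p n))" for i j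
  proof (rule summable_comparison_test')
    show "summable (\<lambda>n. s powr (- \<nu>) * (R / s powr \<beta>) ^ n)"
      using R s by (intro summable_mult summable_geometric) (simp add: field_simps)
    show "norm (norm (matpow Z n $ i $ j) * s powr (- p n)) \<le> s powr (- \<nu>) * (R / s powr \<beta>) ^ n" for n
    proof -
      have "s powr (- p n) = s powr (- \<nu>) / (s powr \<beta>) ^ n"
        using s by (simp add: powr_power p_def powr_diff[symmetric] algebra_simps)
      then show ?thesis
        using norm_matpow_entry_le[of Z n i j] s
        by (simp add: R_def[symmetric] power_divide divide_right_mono mult_left_mono mult.commute)
    qed
  qed
  note laplace_entry = laplace_powr_series[OF s p sums_t abs_t abs_s]
  show "laplace_integrable_mat F s"
    unfolding laplace_integrable_mat_def using laplace_entry(1) by blast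
  show "laplace_mat F s = (s powr (\<beta> - \<nu>)) *\<^sub>R matrix_inv ((s powr \<beta>) *\<^sub>R mat 1 - Z)"
  proof -
    have "laplace (\<lambda>t. F t $ i $ j) s
            = ((s powr (\<beta> - \<nu>)) *\<^sub>R matrix_inv ((s powr \<beta>) *\<^sub>R mat 1 - Z)) $ i $ j" for i j
    proof (rule sums_unique2[OF laplace_entry(2)])
      show "(\<lambda>n. matpow Z n $ i $ j * of_real (s powr (- p n)))
          sums (((s powr (\<beta> - \<nu>)) *\<^sub>R matrix_inv ((s powr \<beta>) *\<^sub>R mat 1 - Z)) $ i $ j)"
        using sums_matrixD[OF sums_scaleR_right[OF neumann_series(2)[OF large],
              of "s powr (\<beta> - \<nu>)"], of i j]
        unfolding s_pow by (simp add: scaleR_conv_of_real[where 'a = complex] mult_ac)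
    qed
    then show ?thesis by (simp add: laplace_mat_def vec_eq_iff)
  qed
qed

theorem theorem2p4:
  fixes \<beta> \<nu> :: real
    and B V :: "real ^ 'n"
    and Z M \<Lambda> N :: "complex ^ 'n ^ 'n"
  assumes beta: "0 < \<beta>" "\<beta> \<le> 1"
    and nu: "0 < \<nu>"
    and B: "B = (\<chi> i. \<beta>)"
    and V: "V = (\<chi> i. \<nu>)"
    and M: "invertible M"
    and Lam: "diagonal \<Lambda>" "range (\<lambda>i. \<Lambda> $ i $ i) = {c. eigenvalue Z c}"
    and N: "nilpotent N"
    and Z: "Z = M ** (\<Lambda> + N) ** matrix_inv M"
  shows "(\<forall>A :: complex ^ 'n ^ 'n. summable (mittag_leffler_term B V A)) \<and>
         mittag_leffler B V Z = M ** mittag_leffler B V (\<Lambda> + N) ** matrix_inv M \<and>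
         (\<forall>\<^sub>F s in at_top.
            laplace_integrable_mat (\<lambda>t. Ipow t (V - 1) ** mittag_leffler B V (Ipow t B ** Z)) s \<and>
            invertible (Ipow s B - Z) \<and>
            laplace_mat (\<lambda>t. Ipow t (V - 1) ** mittag_leffler B V (Ipow t B ** Z)) s
              = Ipow s (B - V) ** matrix_inv (Ipow s B - Z))"
proof (intro conjI allI)
  show "summable (mittag_leffler_term B V A)" for A
    using sums_summable[OF mittag_leffler_sums[OF beta(1) nu]] unfolding B V .
  show "mittag_leffler B V Z = M ** mittag_leffler B V (\<Lambda> + N) ** matrix_inv M"
    unfolding B V Z by (rule mittag_leffler_conjugate[OF beta(1) nu M])
  have vecs: "V - 1 = (\<chi> i. \<nu> - 1)" "B - V = (\<chi> i. \<beta> - \<nu>)"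
    by (simp_all add: B V vec_eq_iff)
  define R where "R = (\<Sum>k\<in>UNIV. \<Sum>l\<in>UNIV. norm (Z $ k $ l))"
  have "filterlim (\<lambda>s::real. s powr \<beta>) at_top at_top"
    using beta(1) by real_asymp
  then have "\<forall>\<^sub>F s in at_top. s powr \<beta> > R"
    by (rule filterlim_at_top_dense[THEN iffD1, rule_format])
  then show "\<forall>\<^sub>F s in at_top.
      laplace_integrable_mat (\<lambda>t. Ipow t (V - 1) ** mittag_leffler B V (Ipow t B ** Z)) s \<and>
      invertible (Ipow s B - Z) \<and>
      laplace_mat (\<lambda>t. Ipow t (V - 1) ** mittag_leffler B V (Ipow t B ** Z)) s
        = Ipow s (B - V) ** matrix_inv (Ipow s B - Z)"
    using eventually_gt_at_top[of 0]
  proof eventually_elim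
    case (elim s)
    show ?case
      unfolding vecs unfolding B V Ipow_const scaleR_mat_1_mult
      using laplace_mittag_leffler[OF beta(1) nu elim(2)] neumann_series(1) elim(1)
      unfolding R_def by blast
  qed
qed

end
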